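(* Let $p\geq 5$ be a prime. Then $$W(p-3,p,x)=\begin{cases} L(p,x) & \text{if } p\equiv \pm 1 \pmod 8,\\ -L(p,-x) & \text{if } p\equiv \pm 3 \pmod 8.\end{cases}$$
   Context: Define the sawtooth function on real numbers by $((x))=x-[x]-1/2$ if $x\notin\mathbb{Z}$ (where $[x]$ is the integer part, i.e. the floor), and $((x))=0$ if $x\in\mathbb{Z}$. For an even integer $r\ge 0$, a positive integer $k$ and an integer $h$, the generalized Dedekind sum is $$s(r,h,k)=\frac{k^r}{r+1}\sum_{j=1}^{k-1}B_{r+1}(j/k)\,((jh/k)),$$ where $B_{r+1}(x)$ is the Bernoulli polynomial of degree $r+1$. For an integer $n$ set $$A(r,k,n)=\sum_{\substack{1\le h\le k\\ (h,k)=1}}\exp\left\{\pi i\, s(r,h,k)-2\pi i hn/k\right\},$$ and define the generalized Wilf polynomial of degree $k$ by $$W(r,k,x)=\prod_{n=1}^{k}\bigl(x-A(r,k,n)\bigr).$$ For a prime $p\ge 5$ and $g$ a primitive root modulo $p^2$, define $$\eta_n=\sum_{j=0}^{p-2}\exp\left\{2\pi i\, g^{pj}(g^p+pn)/p^2\right\},\qquad L(p,x)=\prod_{n=1}^{p}(x-\eta_n).$$ *)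

theory Defs
  imports
    "HOL-Analysis.Analysis"
    "HOL-Computational_Algebra.Polynomial"
    "HOL-Number_Theory.Number_Theory"
begin

text \<open>Bernoulli numbers, with the convention \<open>B\<^sub>1 = -1/2\<close>.\<close>

fun bernoulli :: "nat \<Rightarrow> real" where
  "bernoulli 0 = 1"
| "bernoulli (Suc n) =
     - (\<Sum>k\<le>n. real (Suc (Suc n) choose k) * bernoulli k) / real (Suc (Suc n))"

declare bernoulli.simps(2) [simp del]

definition bernpoly :: "nat \<Rightarrow> real \<Rightarrow> real" where
  "bernpoly n x = (\<Sum>k\<le>n. real (n choose k) * bernoulli k * x ^ (n - k))"

definition sawtooth :: "real \<Rightarrow> real" where
  "sawtooth x = (if x \<in> \<int> then 0 else x - of_int \<lfloor>x\<rfloor> - 1 / 2)"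

definition gen_dedekind_sum :: "nat \<Rightarrow> int \<Rightarrow> nat \<Rightarrow> real" where
  "gen_dedekind_sum r h k =
     real k ^ r / real (r + 1) *
     (\<Sum>j = 1..k - 1. bernpoly (r + 1) (real j / real k)
                       * sawtooth (real j * of_int h / real k))"

definition wilf_sum :: "nat \<Rightarrow> nat \<Rightarrow> int \<Rightarrow> complex" where
  "wilf_sum r k n =
     (\<Sum>h | h \<in> {1..int k} \<and> coprime h (int k).
        exp (of_real pi * \<i> * of_real (gen_dedekind_sum r h k)
             - 2 * of_real pi * \<i> * of_int h * of_int n / of_nat k))"

definition wilf_poly :: "nat \<Rightarrow> nat \<Rightarrow> complex poly" where
  "wilf_poly r k = (\<Prod>n = 1..k. [:- wilf_sum r k (int n), 1:])"

definition gauss_period :: "nat \<Rightarrow> int \<Rightarrow> int \<Rightarrow> complex" where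
  "gauss_period p g n =
     (\<Sum>j = 0..p - 2. exp (2 * of_real pi * \<i> *
        of_int (g ^ (p * j) * (g ^ p + int p * n)) / of_nat (p\<^sup>2)))"

definition period_poly :: "nat \<Rightarrow> int \<Rightarrow> complex poly" where
  "period_poly p g = (\<Prod>n = 1..p. [:- gauss_period p g (int n), 1:])"

text \<open>
  The library predicate \<^const>\<open>residue_primroot\<close> takes natural numbers; an arbitrary integer
  is a primitive root iff its least non-negative residue is.
\<close>

definition int_primroot :: "nat \<Rightarrow> int \<Rightarrow> bool" where
  "int_primroot m g \<longleftrightarrow> residue_primroot m (nat (g mod int m))"

end

theory Submission
  imports Defs
begin

text \<open>
  Write \<open>p\<^sup>2 s(p - 3, h, p) = N\<^sub>h = \<Sum>\<^sub>j f\<^sub>j (j h mod p)\<close>, where \<open>f\<^sub>j = p\<^sup>n S\<^sub>n(j/p)\<close>, \<open>n = p - 2\<close>, and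
  \<open>S\<^sub>n(x) = (B\<^sub>n(x) - B\<^sub>n)/n\<close> interpolates the power sums \<open>\<Sum>\<^bsub>a<x\<^esub> a\<^sup>n\<^sup>-\<^sup>1\<close>. The denominators of the
  coefficients of \<open>S\<^sub>n\<close> are prime to \<open>p\<close>, so that replacing \<open>j/p\<close> by a congruent integer shows that
  each \<open>f\<^sub>j\<close> is an integer and computes it modulo \<open>4\<close>; its leading terms give it modulo \<open>p\<^sup>2\<close>.
  Consequently \<open>N\<^sub>h\<close> is even iff \<open>p\<close> is \<open>\<plusminus>1\<close> modulo \<open>8\<close>, and modulo \<open>p\<^sup>2\<close> it is a unit times \<open>h\<^sup>p\<close>.
  Thus \<open>exp(\<pi> \<i> s)\<close> is, up to the sign \<open>(2/p)\<close>, equal to \<open>exp(2 \<pi> \<i> K h\<^sup>p / p\<^sup>2)\<close> with a unit \<open>K\<close>.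
  Summing over \<open>h = K\<^sup>-\<^sup>1 g\<^sup>j\<^sup>+\<^sup>1\<close>, and using that \<open>x\<^sup>p\<close> modulo \<open>p\<^sup>2\<close> depends only on \<open>x\<close> modulo \<open>p\<close>,
  gives the Gaussian periods, permuted by an affine bijection of the index modulo \<open>p\<close>.
\<close>

section \<open>Bernoulli polynomials: recurrence and difference equation\<close>

lemma sum_choose_bernoulli:
  assumes "n \<ge> 2"
  shows "(\<Sum>k<n. real (n choose k) * bernoulli k) = 0"
proof -
  obtain m where n: "n = Suc (Suc m)"
    using that[of "n - 2"] assms by simp
  have "(\<Sum>k<n. real (n choose k) * bernoulli k) =
      (\<Sum>k\<le>m. real (n choose k) * bernoulli k) + real n * bernoulli (Suc m)"
    by (simp add: n lessThan_Suc_atMost[symmetric] del: binomial_Suc_Suc)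
  then show ?thesis
    by (simp add: n bernoulli.simps(2) del: binomial_Suc_Suc)
qed

text \<open>After expanding \<open>(x + 1) ^ (n - k)\<close> and collecting powers of
  \<open>x\<close>, the coefficient of \<open>x ^ i\<close> is \<open>n choose i\<close> times the
  Bernoulli recurrence of order \<open>n - i\<close>, which vanishes unless
  \<open>n - i = 1\<close>.\<close>

lemma bernpoly_add_one_diff:
  "bernpoly n (x + 1) - bernpoly n x = real n * x ^ (n - 1)"
proof -
  have eq: "real (n choose k) * bernoulli k * (x + 1) ^ (n - k) -
      real (n choose k) * bernoulli k * x ^ (n - k) =
      (\<Sum>i<n - k. real (n choose i) * x ^ i * (real ((n - i) choose k) * bernoulli k))"
    if "k \<le> n" for k
  proof -
    have "(x + 1) ^ (n - k) - x ^ (n - k) = (\<Sum>i<n - k. real ((n - k) choose i) * x ^ i)"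
      by (simp add: binomial_ring lessThan_Suc_atMost[symmetric])
    \<comment> \<open>Both products are the trinomial coefficient splitting \<open>n\<close> into
      \<open>k\<close>, \<open>i\<close> and the rest; each is reached from
      \<open>n choose (k + i)\<close>.\<close>
    moreover have "real (n choose k) * real ((n - k) choose i) =
        real (n choose i) * real ((n - i) choose k)" if "i < n - k" for i
    proof -
      have "(n choose (k + i)) * ((k + i) choose k) = (n choose k) * ((n - k) choose i)"
        using choose_mult[of k "k + i" n] that \<open>k \<le> n\<close> by simp
      moreover have "(n choose (k + i)) * ((k + i) choose i) = (n choose i) * ((n - i) choose k)"
        using choose_mult[of i "k + i" n] that \<open>k \<le> n\<close> by simp
      moreover have "(k + i) choose k = (k + i) choose i"
        using binomial_symmetric[of k "k + i"] by simp
      ultimately show ?thesis by (metis of_nat_mult)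
    qed
    ultimately show ?thesis
      unfolding right_diff_distrib[symmetric]
      by (auto simp: sum_distrib_left mult_ac intro!: sum.cong)
  qed
  have "bernpoly n (x + 1) - bernpoly n x =
      (\<Sum>k\<le>n. \<Sum>i<n - k. real (n choose i) * x ^ i * (real ((n - i) choose k) * bernoulli k))"
    unfolding bernpoly_def sum_subtractf[symmetric] by (intro sum.cong) (use eq in auto)
  \<comment> \<open>Both double sums run over the triangle \<open>k + i < n\<close>.\<close>
  also have "\<dots> = (\<Sum>i<n. \<Sum>k<n - i. real (n choose i) * x ^ i * (real ((n - i) choose k) * bernoulli k))"
    unfolding sum.Sigma[OF finite_atMost ballI[OF finite_lessThan]]
      sum.Sigma[OF finite_lessThan ballI[OF finite_lessThan]]
    by (rule sum.reindex_bij_witness[of _ "\<lambda>(i, k). (k, i)" "\<lambda>(k, i). (i, k)"]) auto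
  also have "\<dots> = (\<Sum>i<n. if i = n - 1 then real n * x ^ (n - 1) else 0)"
  proof (intro sum.cong refl)
    fix i assume i: "i \<in> {..<n}"
    show "(\<Sum>k<n - i. real (n choose i) * x ^ i * (real ((n - i) choose k) * bernoulli k)) =
        (if i = n - 1 then real n * x ^ (n - 1) else 0)"
    proof (cases "i = n - 1")
      case True
      then obtain m where "n = Suc m" "i = m" using i by (cases n) auto
      then show ?thesis by simp
    next
      case False
      then have "n - i \<ge> 2" using i by auto
      from sum_choose_bernoulli[OF this] False show ?thesis
        by (simp add: sum_distrib_left[symmetric])
    qed
  qed
  also have "\<dots> = real n * x ^ (n - 1)"
    by (cases n) auto
  finally show ?thesis .
qed

lemma bernpoly_0 [simp]: "bernpoly n 0 = bernoulli n"
proof -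
  have "bernpoly n 0 = (\<Sum>k\<le>n. if k = n then bernoulli n else 0)"
    unfolding bernpoly_def by (intro sum.cong) auto
  then show ?thesis by simp
qed

section \<open>Power-sum polynomials\<close>

text \<open>Subtracting \<open>bernoulli n\<close> makes the value at 0 vanish, so that the
  difference equation yields power sums at the naturals. The argument is real because the Dedekind
  sum evaluates it at \<open>j / p\<close>.\<close>

definition powersum_fun :: "nat \<Rightarrow> real \<Rightarrow> real" where
  "powersum_fun n x = (bernpoly n x - bernoulli n) / real n"

lemma powersum_fun_add_one:
  "n \<ge> 1 \<Longrightarrow> powersum_fun n (x + 1) = powersum_fun n x + x ^ (n - 1)"
  using bernpoly_add_one_diff[of n x] by (simp add: powersum_fun_def field_simps)

lemma powersum_fun_of_nat:
  "n \<ge> 1 \<Longrightarrow> powersum_fun n (real m) = (\<Sum>a<m. real a ^ (n - 1))"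
  by (induction m) (auto simp: powersum_fun_def[of n 0] powersum_fun_add_one add.commute[of 1])

lemma powersum_fun_eq_sum:
  assumes "n \<ge> 1"
  shows "powersum_fun n x = (\<Sum>k<n. real (n choose k) * bernoulli k / real n * x ^ (n - k))"
proof -
  have "bernpoly n x = (\<Sum>k<n. real (n choose k) * bernoulli k * x ^ (n - k)) + bernoulli n"
    by (simp add: bernpoly_def lessThan_Suc_atMost[symmetric])
  then show ?thesis by (simp add: powersum_fun_def sum_divide_distrib)
qed

text \<open>Both sides are polynomials in \<open>x\<close>, so agreement at all naturals suffices;
  there the difference equation allows an induction. This is the classical symmetry of Bernoulli
  polynomials, normalized to vanish at 0.\<close>

lemma powersum_fun_reflect:
  assumes "n \<ge> 2"
  shows "powersum_fun n (1 - x) = (- 1) ^ n * powersum_fun n x"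
proof -
  define q :: "real poly" where
    "q = (\<Sum>k<n. Polynomial.monom (real (n choose k) * bernoulli k / real n) (n - k))"
  have q: "poly q y = powersum_fun n y" for y
    using assms by (simp add: q_def poly_sum poly_monom powersum_fun_eq_sum)
  define t where "t = pcompose q [:1, -1:] - Polynomial.smult ((-1) ^ n) q"
  have t: "poly t y = powersum_fun n (1 - y) - (-1) ^ n * powersum_fun n y" for y
    by (simp add: t_def poly_pcompose q)
  have "poly t (real m) = 0" for m
  proof (induction m)
    case 0
    \<comment> \<open>The value at 1 is \<open>0 ^ (n - 1)\<close>, which is 0 because
      \<open>n \<ge> 2\<close>.\<close>
    have "powersum_fun n 0 = 0" "powersum_fun n 1 = 0"
      using powersum_fun_of_nat[of n 0] powersum_fun_of_nat[of n 1] assms by auto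
    then show ?case by (simp add: t)
  next
    case (Suc m)
    have "powersum_fun n (1 - real m) = powersum_fun n (- real m) + (- real m) ^ (n - 1)"
      using powersum_fun_add_one[of n "- real m"] assms by simp
    moreover have "powersum_fun n (real m + 1) = powersum_fun n (real m) + real m ^ (n - 1)"
      using powersum_fun_add_one[of n "real m"] assms by simp
    moreover have "(- real m) ^ (n - 1) = - ((-1) ^ n * real m ^ (n - 1))"
      using assms by (cases n) (auto simp: power_minus[of "real m"])
    ultimately show ?case
      using Suc by (simp add: t algebra_simps)
  qed
  then have "range real \<subseteq> {y. poly t y = 0}" by auto
  moreover have "infinite (range real)"
    by (simp add: range_inj_infinite inj_of_nat)
  ultimately have "t = 0"
    using poly_roots_finite finite_subset by blast
  then show ?thesis using t[of x] by simp
qed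

section \<open>Integrality at p and congruences for the scaled power sums\<close>

text \<open>The recurrence for \<open>bernoulli (Suc m)\<close> divides only by
  \<open>m + 2\<close>, which is less than \<open>p\<close>; multiplying the previous
  \<open>D\<close> by it keeps \<open>D\<close> prime to \<open>p\<close>.\<close>

lemma bernoulli_denominator:
  assumes "prime p" "m < p - 1"
  shows "\<exists>D>0. coprime D p \<and> (\<forall>k\<le>m. real D * bernoulli k \<in> \<int>)"
  using assms(2)
proof (induction m)
  case 0
  then show ?case by (intro exI[of _ 1]) auto
next
  case (Suc m)
  then obtain D where D: "D > 0" "coprime D p" "\<And>k. k \<le> m \<Longrightarrow> real D * bernoulli k \<in> \<int>"
    by auto
  have "coprime (m + 2) p"
    using Suc.prems assms(1) by (metis add_2_eq_Suc' add_gr_0 coprime_commute less_diff_conv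
        nat_dvd_not_less plus_1_eq_Suc prime_imp_coprime add.commute Suc_eq_plus1 pos2 add_Suc_right)
  have int: "real D * (\<Sum>k\<le>m. real (Suc (Suc m) choose k) * bernoulli k) \<in> \<int>"
    unfolding sum_distrib_left
    by (intro Ints_sum) (metis D(3) Ints_mult Ints_of_nat atMost_iff mult.left_commute)
  have "real (D * (m + 2)) * bernoulli (Suc m) =
      - (real D * (\<Sum>k\<le>m. real (Suc (Suc m) choose k) * bernoulli k))"
    by (simp add: bernoulli.simps(2) field_simps del: binomial_Suc_Suc)
  then have "real (D * (m + 2)) * bernoulli (Suc m) \<in> \<int>"
    using int by simp
  moreover have "real (D * (m + 2)) * bernoulli k \<in> \<int>" if "k \<le> m" for k
    using Ints_mult[OF D(3)[OF that] Ints_of_nat[of "m + 2"]] by (simp only: of_nat_mult mult_ac)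
  moreover have "coprime (D * (m + 2)) p"
    using D(2) \<open>coprime (m + 2) p\<close> by (simp only: coprime_mult_left_iff)
  ultimately show ?case
    using D(1) by (intro exI[of _ "D * (m + 2)"]) (auto simp: le_Suc_eq simp del: mult_Suc_right add_2_eq_Suc')
qed

text \<open>Clearing denominators by some \<open>D\<close> prime to \<open>p\<close> gives an
  integer \<open>G = D * f\<close>. Replacing \<open>j / p\<close> by an integer \<open>M\<close>
  with \<open>p * M\<close> congruent to \<open>j\<close> modulo \<open>4 * D\<close> shows that
  \<open>D\<close> divides \<open>G\<close> and determines \<open>f\<close> modulo 4. Modulo
  \<open>p^2\<close> only the terms with \<open>bernoulli 0\<close> and \<open>bernoulli 1\<close>
  survive.\<close>

lemma scaled_powersum_fun:
  fixes p n j :: nat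
  assumes p: "prime p" "p > 2" and n: "n \<ge> 2" "n < p"
  obtains f :: int and M :: nat
  where "real_of_int f = real p ^ n * powersum_fun n (real j / real p)"
    and "[p * M = j] (mod 4)"
    and "[f = int (p ^ n * (\<Sum>a<M. a ^ (n - 1)))] (mod 4)"
    and "[2 * int n * f = 2 * int j ^ n - int n * int p * int j ^ (n - 1)] (mod (int p)\<^sup>2)"
proof -
  obtain D0 where D0: "D0 > 0" "coprime D0 p" "\<And>k. k < n \<Longrightarrow> real D0 * bernoulli k \<in> \<int>"
    using bernoulli_denominator[of p "n - 1"] p n by (metis One_nat_def Suc_diff_Suc Suc_leI
        diff_Suc_1 diff_less_mono less_Suc_eq_le less_le_trans one_le_numeral pos2 zero_less_Suc order_refl)
  \<comment> \<open>The factor \<open>n\<close> clears the division by \<open>n\<close> in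
    \<open>powersum_fun\<close>.\<close>
  define D where "D = D0 * n"
  have "coprime n p"
    using p n by (metis coprime_commute less_le_trans nat_dvd_not_less pos2 prime_imp_coprime)
  then have D: "D > 0" "coprime D p" using D0 n by (auto simp: D_def)
  define z where "z k = \<lfloor>real D * (real (n choose k) * bernoulli k / real n)\<rfloor>" for k
  have z: "real_of_int (z k) = real D * (real (n choose k) * bernoulli k / real n)" if "k < n" for k
  proof -
    have "real D * (real (n choose k) * bernoulli k / real n) = real (n choose k) * (real D0 * bernoulli k)"
      using n by (simp add: D_def)
    also have "\<dots> \<in> \<int>" using D0(3)[OF that] by simp
    finally show ?thesis by (simp add: z_def)
  qed
  have Dz: "real D * powersum_fun n x = (\<Sum>k<n. real_of_int (z k) * x ^ (n - k))" for x
    using n z by (simp add: powersum_fun_eq_sum sum_distrib_left mult_ac)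
  \<comment> \<open>Multiplication by \<open>p ^ n\<close> homogenizes the polynomial in
    \<open>j\<close> and \<open>p\<close>, so its value is an integer.\<close>
  define G where "G = (\<Sum>k<n. z k * int p ^ k * int j ^ (n - k))"
  have G: "real_of_int G = real D * (real p ^ n * powersum_fun n (real j / real p))"
  proof -
    have "real D * (real p ^ n * powersum_fun n (real j / real p)) =
        real p ^ n * (\<Sum>k<n. real_of_int (z k) * (real j / real p) ^ (n - k))"
      using Dz[of "real j / real p"] by simp
    also have "\<dots> = (\<Sum>k<n. real_of_int (z k) * real p ^ k * real j ^ (n - k))"
      unfolding sum_distrib_left
    proof (intro sum.cong refl)
      fix k assume "k \<in> {..<n}"
      then have "real p ^ n = real p ^ k * real p ^ (n - k)"
        by (simp add: power_add[symmetric])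
      then show "real p ^ n * (real_of_int (z k) * (real j / real p) ^ (n - k)) =
          real_of_int (z k) * real p ^ k * real j ^ (n - k)"
        using p by (simp add: power_divide)
    qed
    finally show ?thesis by (simp add: G_def)
  qed
  \<comment> \<open>The modulus is \<open>4 * D\<close> so that a congruence modulo 4 remains after
    division by \<open>D\<close>.\<close>
  have "coprime p (4 * D)"
  proof -
    have "odd p" using p prime_odd_nat by auto
    then have "coprime p (2 ^ 2)" by (subst coprime_power_right_iff) simp
    then have "coprime p 4" by simp
    then show ?thesis using D by (simp add: coprime_commute)
  qed
  then obtain u where u: "[p * u = 1] (mod (4 * D))"
    using coprime_iff_invertible_nat by auto
  define M where "M = j * u"
  have M: "[p * M = j] (mod (4 * D))"
    using cong_mult[OF u cong_refl[of j]] by (simp add: M_def mult_ac)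
  define F where "F = (\<Sum>a<M. a ^ (n - 1))"
  have "int D * int F = (\<Sum>k<n. z k * int M ^ (n - k))"
  proof -
    have "real_of_int (int D * int F) = real_of_int (\<Sum>k<n. z k * int M ^ (n - k))"
      using Dz[of "real M"] n by (simp add: powersum_fun_of_nat F_def)
    then show ?thesis by linarith
  qed
  then have *: "int p ^ n * (int D * int F) = (\<Sum>k<n. z k * int p ^ k * (int p * int M) ^ (n - k))"
    unfolding sum_distrib_left
    by (simp add: sum_distrib_left power_mult_distrib mult_ac)
      (intro sum.cong, auto simp: mult_ac power_add[symmetric])
  have "[int (p * M) = int j] (mod int (4 * D))"
    using M cong_int_iff by blast
  then have "[int p ^ n * (int D * int F) = G] (mod int (4 * D))"
    unfolding * G_def by (intro cong_sum cong_mult cong_pow cong_refl) auto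
  then obtain t where t: "G = int p ^ n * (int D * int F) + int (4 * D) * t"
    by (auto simp: cong_iff_lin)
  define f where "f = int (p ^ n * F) + 4 * t"
  have Gf: "G = int D * f" by (simp add: t f_def algebra_simps)
  show thesis
  proof (rule that)
    show "real_of_int f = real p ^ n * powersum_fun n (real j / real p)"
      using G D by (simp add: Gf)
    show "[p * M = j] (mod 4)" using M by (rule cong_modulus_mult_nat)
    show "[f = int (p ^ n * (\<Sum>a<M. a ^ (n - 1)))] (mod 4)"
      by (simp add: f_def F_def cong_def)
    obtain m where m: "n = Suc (Suc m)" using that[of "n - 2"] n by simp
    \<comment> \<open>The two leading coefficients come from \<open>bernoulli 0 = 1\<close> and
      \<open>bernoulli 1 = - 1 / 2\<close>; all later terms carry \<open>p^2\<close>.\<close>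
    have z0: "int n * z 0 = int D"
    proof -
      have "real_of_int (int n * z 0) = real_of_int (int D)" using z[of 0] n by simp
      then show ?thesis by linarith
    qed
    have z1: "2 * z 1 = - int D"
    proof -
      have "real_of_int (2 * z 1) = real_of_int (- int D)"
        using z[of 1] n by (simp add: bernoulli.simps(2)[of 0])
      then show ?thesis by linarith
    qed
    have "G = z 0 * int j ^ n + z 1 * int p * int j ^ (n - 1) +
        (\<Sum>k<m. z (Suc (Suc k)) * int p ^ (Suc (Suc k)) * int j ^ (n - Suc (Suc k)))"
      unfolding G_def m by (simp add: sum.lessThan_Suc_shift del: sum.lessThan_Suc)
    also have "(\<Sum>k<m. z (Suc (Suc k)) * int p ^ (Suc (Suc k)) * int j ^ (n - Suc (Suc k))) =
        (int p)\<^sup>2 * (\<Sum>k<m. z (Suc (Suc k)) * int p ^ k * int j ^ (n - Suc (Suc k)))"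
      by (simp add: sum_distrib_left power2_eq_square mult_ac)
    finally obtain w where w: "G = z 0 * int j ^ n + z 1 * int p * int j ^ (n - 1) + (int p)\<^sup>2 * w"
      by blast
    have "int D * (2 * int n * f) = 2 * int n * G" by (simp add: Gf)
    also have "\<dots> = 2 * (int n * z 0) * int j ^ n + int n * (2 * z 1) * int p * int j ^ (n - 1)
        + (int p)\<^sup>2 * (2 * int n * w)"
      by (simp add: w algebra_simps)
    also have "\<dots> = int D * (2 * int j ^ n - int n * int p * int j ^ (n - 1)) + (int p)\<^sup>2 * (2 * int n * w)"
      by (simp only: z0 z1) (simp add: algebra_simps)
    finally have "[int D * (2 * int n * f) = int D * (2 * int j ^ n - int n * int p * int j ^ (n - 1))] (mod (int p)\<^sup>2)"
      by (simp add: cong_def)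
    moreover have "coprime (int D) ((int p)\<^sup>2)" using D by simp
    ultimately show "[2 * int n * f = 2 * int j ^ n - int n * int p * int j ^ (n - 1)] (mod (int p)\<^sup>2)"
      using cong_mult_lcancel by blast
  qed
qed

section \<open>The Dedekind sum as a sum of integers\<close>

lemma sum_odd_reflection:
  fixes g :: "nat \<Rightarrow> real"
  assumes "\<And>j. j \<in> {1..k - 1} \<Longrightarrow> g (k - j) = - g j"
  shows "(\<Sum>j = 1..k - 1. g j) = 0"
proof -
  have "(\<Sum>j = 1..k - 1. g j) = (\<Sum>j = 1..k - 1. g (k - 1 + 1 - j))"
    by (rule sum.atLeastAtMost_rev)
  also have "\<dots> = (\<Sum>j = 1..k - 1. - g j)"
    using assms by (intro sum.cong) auto
  finally show ?thesis by (simp add: sum_negf)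
qed

lemma not_dvd_mult_coprime:
  assumes "coprime h (int k)" "j \<in> {1..k - 1}"
  shows "\<not> int k dvd int j * h"
proof
  assume "int k dvd int j * h"
  then have "int k dvd int j"
    using assms(1) coprime_commute coprime_dvd_mult_left_iff by blast
  then show False using assms(2) by (auto dest!: dvd_imp_le)
qed

lemma sawtooth_mult_div:
  assumes "coprime h (int k)" "j \<in> {1..k - 1}"
  shows "sawtooth (real j * of_int h / real k) = real_of_int (int j * h mod int k) / real k - 1 / 2"
proof -
  have k: "k > 0" using assms(2) by auto
  have eq: "real j * of_int h / real k = real_of_int (int j * h) / real_of_int (int k)" by simp
  have fl: "\<lfloor>real j * of_int h / real k\<rfloor> = int j * h div int k"
    unfolding eq by (rule floor_divide_of_int_eq)
  have md: "real_of_int (int j * h) - real_of_int (int k) * real_of_int (int j * h div int k)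
      = real_of_int (int j * h mod int k)"
    by (simp only: minus_mult_div_eq_mod flip: of_int_mult of_int_diff)
  then have diff: "real j * of_int h / real k - of_int (int j * h div int k) =
      real_of_int (int j * h mod int k) / real k"
    using k by (simp add: field_simps)
  have "real j * of_int h / real k \<notin> \<int>"
  proof
    assume "real j * of_int h / real k \<in> \<int>"
    then have "real j * of_int h / real k = of_int (int j * h div int k)"
      using fl by (metis Ints_cases floor_of_int)
    with diff k have "int j * h mod int k = 0" by simp
    then show False using not_dvd_mult_coprime[OF assms] by (simp add: dvd_eq_mod_eq_0)
  qed
  then show ?thesis by (simp add: sawtooth_def fl diff)
qed

lemma mod_mult_reflect:
  assumes "coprime h (int k)" "j \<in> {1..k - 1}"
  shows "int (k - j) * h mod int k = int k - int j * h mod int k"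
proof -
  have "int (k - j) * h = - (int j * h) + h * int k"
    using assms(2) by (auto simp: of_nat_diff algebra_simps)
  then have "int (k - j) * h mod int k = - (int j * h) mod int k"
    by (simp only: mod_mult_self1)
  then show ?thesis
    using not_dvd_mult_coprime[OF assms] by (simp add: zmod_zminus1_eq_if dvd_eq_mod_eq_0)
qed

text \<open>The Bernoulli value is a constant plus a multiple of \<open>f j\<close>, and the
  sawtooth is a residue over \<open>k\<close> minus 1/2. Both \<open>f\<close> and the sawtooth
  change sign under \<open>j \<mapsto> k - j\<close> (\<open>r + 1\<close> is odd), so the two
  constants contribute nothing.\<close>

lemma gen_dedekind_sum_eq_sum_mod:
  fixes f :: "nat \<Rightarrow> int"
  assumes r: "even r" "r > 0" and h: "coprime h (int k)"
    and f: "\<And>j. real_of_int (f j) = real k ^ (r + 1) * powersum_fun (r + 1) (real j / real k)"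
  shows "(real k)\<^sup>2 * gen_dedekind_sum r h k = real_of_int (\<Sum>j = 1..k - 1. f j * (int j * h mod int k))"
    and "\<And>j. j \<in> {1..k - 1} \<Longrightarrow> f (k - j) = - f j"
proof -
  show anti: "f (k - j) = - f j" if "j \<in> {1..k - 1}" for j
  proof -
    have "real (k - j) / real k = 1 - real j / real k"
      using that by (auto simp: field_simps of_nat_diff)
    then have "real_of_int (f (k - j)) = real_of_int (- f j)"
      using r by (simp add: f powersum_fun_reflect)
    then show ?thesis by linarith
  qed
  show "(real k)\<^sup>2 * gen_dedekind_sum r h k = real_of_int (\<Sum>j = 1..k - 1. f j * (int j * h mod int k))"
  proof (cases "k = 0")
    case True
    then show ?thesis by (simp add: gen_dedekind_sum_def)
  next
    case False
    define s where "s j = sawtooth (real j * of_int h / real k)" for j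
    have s: "s j = real_of_int (int j * h mod int k) / real k - 1 / 2" if "j \<in> {1..k - 1}" for j
      unfolding s_def using sawtooth_mult_div[OF h that] .
    have s0: "(\<Sum>j = 1..k - 1. s j) = 0"
    proof (rule sum_odd_reflection)
      fix j assume j: "j \<in> {1..k - 1}"
      then have "k - j \<in> {1..k - 1}" by auto
      show "s (k - j) = - s j"
        unfolding s[OF \<open>k - j \<in> {1..k - 1}\<close>] s[OF j] mod_mult_reflect[OF h j]
        using False by (simp add: diff_divide_distrib)
    qed
    have f0: "(\<Sum>j = 1..k - 1. real_of_int (f j)) = 0"
      by (rule sum_odd_reflection) (simp add: anti)
    \<comment> \<open>The first and third summands on the right are the contributions of the
      constants \<open>bernoulli (r + 1)\<close> and 1/2; they vanish on summation by
      \<open>s0\<close> and \<open>f0\<close>.\<close>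
    have eq: "(real k)\<^sup>2 * (real k ^ r / real (r + 1)) * (bernpoly (r + 1) (real j / real k) * s j) =
        (real k)\<^sup>2 * (real k ^ r / real (r + 1)) * bernoulli (r + 1) * s j +
        real_of_int (f j * (int j * h mod int k)) - real k / 2 * real_of_int (f j)"
      if "j \<in> {1..k - 1}" for j
    proof -
      have "bernpoly (r + 1) (real j / real k) =
          bernoulli (r + 1) + real (r + 1) * powersum_fun (r + 1) (real j / real k)"
        by (simp add: powersum_fun_def)
      moreover have "(real k)\<^sup>2 * (real k ^ r / real (r + 1)) *
          (real (r + 1) * powersum_fun (r + 1) (real j / real k) * s j) = real k * real_of_int (f j) * s j"
        unfolding f by (simp add: power2_eq_square)
      moreover have "real k * real_of_int (f j) * s j =
          real_of_int (f j * (int j * h mod int k)) - real k / 2 * real_of_int (f j)"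
      proof -
        have "real k * s j = real_of_int (int j * h mod int k) - real k / 2"
          using False by (simp add: s[OF that] right_diff_distrib)
        then have "real_of_int (f j) * (real k * s j) =
            real_of_int (f j) * (real_of_int (int j * h mod int k) - real k / 2)"
          by simp
        then show ?thesis by (simp add: right_diff_distrib mult_ac)
      qed
      ultimately show ?thesis
        by (simp only: distrib_left distrib_right mult.assoc)
    qed
    have "(real k)\<^sup>2 * gen_dedekind_sum r h k =
        (\<Sum>j = 1..k - 1. (real k)\<^sup>2 * (real k ^ r / real (r + 1)) * (bernpoly (r + 1) (real j / real k) * s j))"
      by (simp only: gen_dedekind_sum_def s_def mult.assoc flip: sum_distrib_left)
    also have "\<dots> = (real k)\<^sup>2 * (real k ^ r / real (r + 1)) * bernoulli (r + 1) * (\<Sum>j = 1..k - 1. s j) +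
        (\<Sum>j = 1..k - 1. real_of_int (f j * (int j * h mod int k))) -
        real k / 2 * (\<Sum>j = 1..k - 1. real_of_int (f j))"
      unfolding sum_distrib_left sum.distrib[symmetric] sum_subtractf[symmetric]
      by (rule sum.cong[OF refl eq])
    finally show ?thesis
      by (simp only: s0 f0) simp
  qed
qed

section \<open>Parity of the integer sum\<close>

text \<open>Since \<open>a ^ e\<close> and \<open>a\<close> have the same parity, this is the parity
  of the triangular number \<open>M * (M - 1) / 2\<close>.\<close>

lemma even_powersum_iff:
  fixes e M :: nat
  assumes "e > 0"
  shows "even (\<Sum>a<M. a ^ e) \<longleftrightarrow> M mod 4 = 0 \<or> M mod 4 = 1"
  using assms by (induction M) (auto, presburger+)

text \<open>The two patterns belong to \<open>p\<close> congruent to 1 and to 3 modulo 4, where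
  \<open>p * M = j\<close> modulo 4 means that \<open>M\<close> is \<open>j\<close> and
  \<open>- j\<close>, respectively.\<close>

lemma even_sum_iff_mod_4:
  fixes f :: "nat \<Rightarrow> int"
  shows "(\<And>j. even (f j) \<longleftrightarrow> j mod 4 = 0 \<or> j mod 4 = 1) \<Longrightarrow>
      even (\<Sum>j = 1..q. f j) \<longleftrightarrow> q mod 4 \<noteq> 2"
    and "(\<And>j. even (f j) \<longleftrightarrow> j mod 4 = 0 \<or> j mod 4 = 3) \<Longrightarrow>
      even (\<Sum>j = 1..q. f j) \<longleftrightarrow> q mod 4 \<noteq> 1"
  by (induction q; simp; presburger)+

text \<open>Pairing \<open>j\<close> with \<open>p - j\<close> gives \<open>f j\<close> times an odd
  number, so \<open>h\<close> drops out and only the parity of the sum of \<open>f j\<close> over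
  \<open>j \<le> (p - 1) / 2\<close> matters.\<close>

lemma even_sum_mult_mod:
  fixes f :: "nat \<Rightarrow> int"
  assumes "odd p" and h: "coprime h (int p)"
    and anti: "\<And>j. j \<in> {1..p - 1} \<Longrightarrow> f (p - j) = - f j"
    and parity: "\<And>j. \<exists>M. [p * M = j] (mod 4) \<and> (even (f j) \<longleftrightarrow> M mod 4 = 0 \<or> M mod 4 = 1)"
  shows "even (\<Sum>j = 1..p - 1. f j * (int j * h mod int p)) \<longleftrightarrow> p mod 8 = 1 \<or> p mod 8 = 7"
proof -
  obtain q where q: "p = 2 * q + 1" using \<open>odd p\<close> oddE by blast
  define t where "t j = f j * (int j * h mod int p)" for j
  have "{1..p - 1} = {1..q} \<union> {q + 1..p - 1}" using q by auto
  then have "(\<Sum>j = 1..p - 1. t j) = (\<Sum>j = 1..q. t j) + (\<Sum>j = q + 1..p - 1. t j)"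
    by (simp add: sum.union_disjoint)
  also have "(\<Sum>j = q + 1..p - 1. t j) = (\<Sum>j = 1..q. t (p - j))"
    by (rule sum.reindex_bij_witness[of _ "\<lambda>j. p - j" "\<lambda>j. p - j"]) (use q in auto)
  also have "(\<Sum>j = 1..q. t j) + (\<Sum>j = 1..q. t (p - j)) = (\<Sum>j = 1..q. t j + t (p - j))"
    by (simp add: sum.distrib)
  \<comment> \<open>With \<open>r\<close> the residue of \<open>j * h\<close>, the pair contributes
    \<open>f j * (2 * r - p)\<close>, where \<open>p = 2 * q + 1\<close>.\<close>
  also have "\<dots> = (\<Sum>j = 1..q. 2 * (f j * (int j * h mod int p - int q - 1)) + f j)"
  proof (rule sum.cong[OF refl])
    fix j assume "j \<in> {1..q}"
    then have j: "j \<in> {1..p - 1}" using q by auto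
    have "int p = 2 * int q + 1" using q by simp
    then show "t j + t (p - j) = 2 * (f j * (int j * h mod int p - int q - 1)) + f j"
      unfolding t_def anti[OF j] mod_mult_reflect[OF h j] by (simp only:) (simp add: algebra_simps)
  qed
  also have "even \<dots> \<longleftrightarrow> even (\<Sum>j = 1..q. f j)"
    by (simp add: sum.distrib flip: sum_distrib_left)
  also have "\<dots> \<longleftrightarrow> p mod 8 = 1 \<or> p mod 8 = 7"
  proof (cases "p mod 4 = 1")
    case True
    have "even (f j) \<longleftrightarrow> j mod 4 = 0 \<or> j mod 4 = 1" for j
    proof -
      obtain M where M: "[p * M = j] (mod 4)" "even (f j) \<longleftrightarrow> M mod 4 = 0 \<or> M mod 4 = 1"
        using parity[of j] that by metis
      have "[p * M = 1 * M] (mod 4)"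
        by (intro cong_mult cong_refl) (use True in \<open>simp add: cong_def\<close>)
      with M show ?thesis by (simp add: cong_def)
    qed
    from even_sum_iff_mod_4(1)[of f, OF this] have "even (\<Sum>j = 1..q. f j) \<longleftrightarrow> q mod 4 \<noteq> 2" .
    then show ?thesis using True q by presburger
  next
    case False
    then have p3: "p mod 4 = 3" using \<open>odd p\<close> by presburger
    have "even (f j) \<longleftrightarrow> j mod 4 = 0 \<or> j mod 4 = 3" for j
    proof -
      obtain M where M: "[p * M = j] (mod 4)" "even (f j) \<longleftrightarrow> M mod 4 = 0 \<or> M mod 4 = 1"
        using parity[of j] that by metis
      have "[p * M = 3 * M] (mod 4)"
        by (intro cong_mult cong_refl) (use p3 in \<open>simp add: cong_def\<close>)
      then have "[3 * M = j] (mod 4)" using M(1) cong_sym cong_trans by blast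
      then have "(3 * M) mod 4 = j mod 4" by (simp add: cong_def)
      moreover have "M mod 4 = 0 \<or> M mod 4 = 1 \<longleftrightarrow> (3 * M) mod 4 = 0 \<or> (3 * M) mod 4 = 3"
        by presburger
      ultimately show ?thesis using M(2) by simp
    qed
    from even_sum_iff_mod_4(2)[of f, OF this] have "even (\<Sum>j = 1..q. f j) \<longleftrightarrow> q mod 4 \<noteq> 1" .
    moreover have "q mod 4 \<noteq> 1 \<longleftrightarrow> p mod 8 = 1 \<or> p mod 8 = 7"
    proof -
      define t where "t = q div 4"
      have "q mod 4 < 4" by simp
      then consider "q = 4 * t" | "q = 4 * t + 1" | "q = 4 * t + 2" | "q = 4 * t + 3"
        using div_mult_mod_eq[of q 4] unfolding t_def by linarith
      then show ?thesis
      proof cases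
        case 1
        then have "p = 1 + 4 * (2 * t)" using q by simp
        then have "p mod 4 = 1" by (simp only: mod_mult_self2) simp
        then show ?thesis using p3 by simp
      next
        case 2
        then have "p = 3 + 8 * t" "q = 1 + 4 * t" using q by auto
        then have "p mod 8 = 3" "q mod 4 = 1" by (simp_all only: mod_mult_self2) simp_all
        then show ?thesis by simp
      next
        case 3
        then have "p = 1 + 4 * (2 * t + 1)" using q by simp
        then have "p mod 4 = 1" by (simp only: mod_mult_self2) simp
        then show ?thesis using p3 by simp
      next
        case 4
        then have "p = 7 + 8 * t" "q = 3 + 4 * t" using q by auto
        then have "p mod 8 = 7" "q mod 4 = 3" by (simp_all only: mod_mult_self2) simp_all
        then show ?thesis by simp
      qed
    qed
    ultimately show ?thesis by simp
  qed
  finally show ?thesis unfolding t_def .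
qed

section \<open>Congruences modulo the square of p\<close>

lemma fermat_theorem_int:
  fixes x :: int
  assumes "prime p" "\<not> int p dvd x"
  shows "[x ^ (p - 1) = 1] (mod int p)"
proof -
  define y where "y = nat (x mod int p)"
  have p: "p > 0" using assms(1) prime_gt_0_nat by blast
  then have y: "[x = int y] (mod int p)" by (simp add: y_def cong_def)
  then have "\<not> p dvd y" using assms(2) by (metis cong_dvd_iff int_dvd_int_iff)
  then have "[int (y ^ (p - 1)) = int 1] (mod int p)"
    unfolding cong_int_iff using fermat_theorem[OF assms(1)] by blast
  then show ?thesis using cong_pow[OF y, of "p - 1"] by (metis cong_trans of_nat_1 of_nat_power)
qed

text \<open>In the factorization of \<open>x ^ p - y ^ p\<close>, the cofactor of
  \<open>x - y\<close> has \<open>p\<close> terms, each congruent to \<open>y ^ (p - 1)\<close>;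
  hence both factors are divisible by \<open>p\<close>.\<close>

lemma cong_power_prime_square:
  fixes x y :: int
  assumes "[x = y] (mod int p)"
  shows "[x ^ p = y ^ p] (mod (int p)\<^sup>2)"
proof -
  have "[(\<Sum>i<p. y ^ (p - Suc i) * x ^ i) = (\<Sum>i<p. y ^ (p - 1))] (mod int p)"
  proof (rule cong_sum)
    fix i assume "i \<in> {..<p}"
    then have "y ^ (p - 1) = y ^ (p - Suc i) * y ^ i" by (simp flip: power_add)
    then show "[y ^ (p - Suc i) * x ^ i = y ^ (p - 1)] (mod int p)"
      using cong_scalar_left[OF cong_pow[OF assms]] by simp
  qed
  then have "int p dvd (\<Sum>i<p. y ^ (p - Suc i) * x ^ i)"
    by (simp add: cong_dvd_iff)
  moreover have "int p dvd x - y" using assms by (simp add: cong_iff_dvd_diff)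
  ultimately have "int p * int p dvd x ^ p - y ^ p"
    unfolding power_diff_sumr2 by (rule mult_dvd_mono[rotated])
  then show ?thesis by (simp add: cong_iff_dvd_diff power2_eq_square)
qed

lemma cong_mult_modulus:
  fixes a b m :: int
  assumes "[a = b] (mod m)"
  shows "[m * a = m * b] (mod m\<^sup>2)"
proof -
  have "m * m dvd m * (a - b)"
    using assms by (intro mult_dvd_mono) (auto simp: cong_iff_dvd_diff)
  then show ?thesis by (simp add: cong_iff_dvd_diff power2_eq_square right_diff_distrib)
qed

lemma bij_betw_mod:
  fixes F :: "'a \<Rightarrow> int"
  assumes "\<And>x y. x \<in> A \<Longrightarrow> y \<in> A \<Longrightarrow> [F x = F y] (mod m) \<Longrightarrow> x = y"
    and "\<And>x. x \<in> A \<Longrightarrow> F x mod m \<in> T" and "finite T" "card A = card T"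
  shows "bij_betw (\<lambda>x. F x mod m) A T"
proof -
  have "inj_on (\<lambda>x. F x mod m) A" using assms(1) by (auto simp: inj_on_def cong_def)
  moreover from this have "(\<lambda>x. F x mod m) ` A = T"
    using assms(2-4) by (intro card_subset_eq) (auto simp: card_image)
  ultimately show ?thesis by (simp add: bij_betw_def)
qed

lemma bij_betw_mult_mod:
  assumes "prime p" "coprime h (int p)"
  shows "bij_betw (\<lambda>j. int j * h mod int p) {1..p - 1} {1..int p - 1}"
proof (rule bij_betw_mod)
  fix i j assume ij: "i \<in> {1..p - 1}" "j \<in> {1..p - 1}" "[int i * h = int j * h] (mod int p)"
  then have "[int i = int j] (mod int p)" using assms(2) cong_mult_rcancel by blast
  then have "[i = j] (mod p)" by (simp add: cong_int_iff)
  then show "i = j" using ij by (intro cong_less_modulus_unique_nat) auto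
next
  fix j assume j: "j \<in> {1..p - 1}"
  have "int j * h mod int p \<noteq> 0"
    using not_dvd_mult_coprime[OF assms(2) j] by (simp add: dvd_eq_mod_eq_0)
  moreover have "int j * h mod int p \<ge> 0" "int j * h mod int p < int p"
    using j by auto
  ultimately show "int j * h mod int p \<in> {1..int p - 1}" by auto
qed auto

text \<open>The reflection \<open>j \<mapsto> p - j\<close> shows that the sum is congruent to its
  own negative, and 2 is invertible modulo \<open>p\<close>.\<close>

lemma prime_dvd_sum_odd_power:
  assumes "odd p" "odd n"
  shows "int p dvd (\<Sum>j = 1..p - 1. int j ^ n)"
proof -
  define S where "S = (\<Sum>j = 1..p - 1. int j ^ n)"
  have "S = (\<Sum>j = 1..p - 1. int (p - 1 + 1 - j) ^ n)"
    unfolding S_def by (rule sum.atLeastAtMost_rev)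
  also have "[\<dots> = (\<Sum>j = 1..p - 1. (- int j) ^ n)] (mod int p)"
    by (intro cong_sum cong_pow) (auto simp: cong_iff_dvd_diff of_nat_diff)
  also have "(\<Sum>j = 1..p - 1. (- int j) ^ n) = - S"
    using assms by (simp add: S_def sum_negf)
  finally have "int p dvd 2 * S" by (simp add: cong_iff_dvd_diff)
  moreover have "coprime (int p) 2" using assms(1) by simp
  ultimately show ?thesis unfolding S_def using coprime_dvd_mult_right_iff by blast
qed

text \<open>
  The exponent \<open>p - 2\<close> turns \<open>j\<^sup>p\<^sup>-\<^sup>2 r\<close>, for \<open>r = j h mod p\<close>, into \<open>h\<^sup>p\<close> up to Fermat quotients:
  \<open>r\<^sup>p\<^sup>-\<^sup>1\<close> is \<open>1\<close> modulo \<open>p\<close>, hence \<open>r = r\<^sup>p (2 - r\<^sup>p\<^sup>-\<^sup>1)\<close> modulo \<open>p\<^sup>2\<close>.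
\<close>

lemma cong_power_mult_residue:
  fixes j r h :: int
  assumes p: "prime p" "p > 2" and "\<not> int p dvd j" "\<not> int p dvd r" and r: "[r = j * h] (mod int p)"
  shows "[j ^ (p - 2) * r = h ^ p * (2 * j ^ (p - 1) - r ^ (p - 1))] (mod (int p)\<^sup>2)"
proof -
  obtain \<alpha> where \<alpha>: "j ^ (p - 1) = 1 + int p * \<alpha>"
    using fermat_theorem_int[OF p(1) assms(3)] by (metis cong_iff_lin cong_sym)
  obtain \<beta> where \<beta>: "r ^ (p - 1) = 1 + int p * \<beta>"
    using fermat_theorem_int[OF p(1) assms(4)] by (metis cong_iff_lin cong_sym)
  have pow: "x * x ^ (p - 1) = x ^ p" for x :: int
    using p by (simp add: power_eq_if)
  have "r - r ^ p * (2 - r ^ (p - 1)) = r * (1 - r ^ (p - 1) * (2 - r ^ (p - 1)))"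
    unfolding pow[symmetric, of r] by (simp add: algebra_simps)
  also have "\<dots> = (int p)\<^sup>2 * (r * \<beta>\<^sup>2)"
    unfolding \<beta> by (simp add: algebra_simps power2_eq_square)
  finally have "[r = r ^ p * (2 - r ^ (p - 1))] (mod (int p)\<^sup>2)"
    by (simp add: cong_iff_dvd_diff)
  also have "[r ^ p * (2 - r ^ (p - 1)) = (j * h) ^ p * (2 - r ^ (p - 1))] (mod (int p)\<^sup>2)"
    using cong_power_prime_square[OF r] cong_scalar_right by blast
  finally have "[j ^ (p - 2) * r = j ^ (p - 2) * ((j * h) ^ p * (2 - r ^ (p - 1)))] (mod (int p)\<^sup>2)"
    by (rule cong_scalar_left)
  also have "j ^ (p - 2) * ((j * h) ^ p * (2 - r ^ (p - 1))) =
      h ^ p * ((j ^ (p - 1))\<^sup>2 * (2 - r ^ (p - 1)))"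
  proof -
    have "j ^ (p - 2) * j ^ p = (j ^ (p - 1))\<^sup>2"
    proof -
      have "p - 2 + p = (p - 1) * 2" using p by simp
      then show ?thesis by (simp only: flip: power_add power_mult)
    qed
    then show ?thesis by (simp add: power_mult_distrib mult_ac)
  qed
  also have "[\<dots> = h ^ p * (2 * j ^ (p - 1) - r ^ (p - 1))] (mod (int p)\<^sup>2)"
  proof (rule cong_scalar_left)
    \<comment> \<open>Modulo \<open>p^2\<close> both expressions are
      \<open>1 + p * (2 * \<alpha> - \<beta>)\<close>.\<close>
    have "(j ^ (p - 1))\<^sup>2 * (2 - r ^ (p - 1)) - (2 * j ^ (p - 1) - r ^ (p - 1)) =
        (int p)\<^sup>2 * (\<alpha>\<^sup>2 - 2 * \<alpha> * \<beta> - int p * \<alpha>\<^sup>2 * \<beta>)"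
      unfolding \<alpha> \<beta> by (simp add: algebra_simps power2_eq_square)
    then show "[(j ^ (p - 1))\<^sup>2 * (2 - r ^ (p - 1)) = 2 * j ^ (p - 1) - r ^ (p - 1)] (mod (int p)\<^sup>2)"
      by (simp add: cong_iff_dvd_diff)
  qed
  finally show ?thesis .
qed

text \<open>The leading term of \<open>f j\<close> contributes \<open>h ^ p\<close> times a
  combination of \<open>(p - 1)\<close>-st powers. Because the residues of \<open>j * h\<close>
  permute those of \<open>j\<close>, these powers sum to \<open>2 * C - C\<close>. The second term
  of \<open>f j\<close> sums to 0 modulo \<open>p^2\<close>.\<close>

lemma sum_mult_mod_cong:
  fixes f :: "nat \<Rightarrow> int"
  assumes p: "prime p" "p > 2" and h: "coprime h (int p)"
    and f: "\<And>j. [2 * int (p - 2) * f j = 2 * int j ^ (p - 2) - int (p - 2) * int p * int j ^ (p - 3)]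
        (mod (int p)\<^sup>2)"
  shows "[int (p - 2) * (\<Sum>j = 1..p - 1. f j * (int j * h mod int p)) =
      (\<Sum>j = 1..p - 1. int j ^ (p - 1)) * h ^ p] (mod (int p)\<^sup>2)"
proof -
  define n where "n = p - 2"
  have "odd p" using p prime_odd_nat by auto
  then have n: "p - 3 = n - 1" "odd n" "n > 0" using p by (auto simp: n_def)
  define r where "r j = int j * h mod int p" for j
  define C where "C = (\<Sum>j = 1..p - 1. int j ^ (p - 1))"
  have "2 * (int n * (\<Sum>j = 1..p - 1. f j * r j)) = (\<Sum>j = 1..p - 1. 2 * int n * f j * r j)"
    by (simp add: sum_distrib_left mult_ac)
  also have "[\<dots> = (\<Sum>j = 1..p - 1. 2 * (h ^ p * (2 * int j ^ (p - 1) - r j ^ (p - 1))) -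
      int p * (int n * h * int j ^ n))] (mod (int p)\<^sup>2)"
  proof (rule cong_sum)
    fix j assume j: "j \<in> {1..p - 1}"
    have rj: "[r j = int j * h] (mod int p)" by (simp add: r_def cong_def)
    have "\<not> int p dvd int j * h" by (rule not_dvd_mult_coprime[OF h j])
    then have nd: "\<not> int p dvd int j" "\<not> int p dvd r j"
      using rj by (auto simp: cong_dvd_iff)
    have "[2 * int n * f j * r j = (2 * int j ^ n - int n * int p * int j ^ (n - 1)) * r j] (mod (int p)\<^sup>2)"
      using f[of j] unfolding n(1) n_def[symmetric] by (rule cong_scalar_right)
    also have "(2 * int j ^ n - int n * int p * int j ^ (n - 1)) * r j =
        2 * (int j ^ n * r j) - int p * (int n * int j ^ (n - 1) * r j)"
      by (simp add: algebra_simps)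
    also have "[\<dots> = 2 * (h ^ p * (2 * int j ^ (p - 1) - r j ^ (p - 1))) -
        int p * (int n * h * int j ^ n)] (mod (int p)\<^sup>2)"
    proof (intro cong_diff)
      show "[2 * (int j ^ n * r j) = 2 * (h ^ p * (2 * int j ^ (p - 1) - r j ^ (p - 1)))] (mod (int p)\<^sup>2)"
        unfolding n_def using cong_power_mult_residue[OF p nd rj] by (rule cong_scalar_left)
      \<comment> \<open>This term already has a factor \<open>p\<close>, so \<open>r j\<close>
        matters only modulo \<open>p\<close>.\<close>
      have "int n * h * int j ^ n = int n * int j ^ (n - 1) * (int j * h)"
        using n by (cases n) auto
      moreover have "[int n * int j ^ (n - 1) * r j = int n * int j ^ (n - 1) * (int j * h)] (mod int p)"
        using rj by (rule cong_scalar_left)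
      ultimately show "[int p * (int n * int j ^ (n - 1) * r j) = int p * (int n * h * int j ^ n)] (mod (int p)\<^sup>2)"
        by (simp only: cong_mult_modulus)
    qed
    finally show "[2 * int n * f j * r j = 2 * (h ^ p * (2 * int j ^ (p - 1) - r j ^ (p - 1))) -
        int p * (int n * h * int j ^ n)] (mod (int p)\<^sup>2)" .
  qed
  also have "(\<Sum>j = 1..p - 1. 2 * (h ^ p * (2 * int j ^ (p - 1) - r j ^ (p - 1))) -
      int p * (int n * h * int j ^ n)) =
      2 * h ^ p * (2 * C - (\<Sum>j = 1..p - 1. r j ^ (p - 1))) - int p * (int n * h) * (\<Sum>j = 1..p - 1. int j ^ n)"
    by (simp add: C_def sum_subtractf sum_distrib_left right_diff_distrib mult_ac)
  \<comment> \<open>The permutation of residues removes the dependence on \<open>h\<close>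
    here.\<close>
  also have "(\<Sum>j = 1..p - 1. r j ^ (p - 1)) = (\<Sum>x = 1..int p - 1. x ^ (p - 1))"
    unfolding r_def by (rule sum.reindex_bij_betw[OF bij_betw_mult_mod[OF p(1) h]])
  also have "\<dots> = C"
    unfolding C_def
    by (rule sum.reindex_bij_witness[of _ int nat]) auto
  also have "[2 * h ^ p * (2 * C - C) - int p * (int n * h) * (\<Sum>j = 1..p - 1. int j ^ n) =
      2 * (C * h ^ p)] (mod (int p)\<^sup>2)"
  proof -
    obtain w where "(\<Sum>j = 1..p - 1. int j ^ n) = int p * w"
      using prime_dvd_sum_odd_power[OF \<open>odd p\<close> n(2)] by (rule dvdE)
    then show ?thesis
      by (simp add: cong_iff_dvd_diff power2_eq_square algebra_simps)
  qed
  finally have "[2 * (int n * (\<Sum>j = 1..p - 1. f j * r j)) = 2 * (C * h ^ p)] (mod (int p)\<^sup>2)" .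
  moreover have "coprime 2 ((int p)\<^sup>2)" using \<open>odd p\<close> by simp
  ultimately show ?thesis
    unfolding n_def[symmetric] r_def[symmetric] C_def[symmetric] using cong_mult_lcancel by blast
qed

section \<open>Exponentials of the Dedekind sum\<close>

definition unity_exp :: "nat \<Rightarrow> int \<Rightarrow> complex" where
  "unity_exp k m = exp (2 * of_real pi * \<i> * of_int m / of_nat k)"

lemma unity_exp_cong:
  assumes "[a = b] (mod int k)" "k > 0"
  shows "unity_exp k a = unity_exp k b"
proof -
  obtain t where "a = b + int k * t" using assms(1) by (metis cong_iff_lin cong_sym)
  then have "2 * of_real pi * \<i> * of_int a / of_nat k =
      2 * of_real pi * \<i> * of_int b / of_nat k + 2 * of_real pi * \<i> * (of_int t :: complex)"
    using assms(2) by (simp add: field_simps)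
  moreover have "exp (2 * of_real pi * \<i> * (of_int t :: complex)) = 1"
    using exp_integer_2pi[of "of_int t"] by (simp add: mult_ac)
  ultimately show ?thesis
    unfolding unity_exp_def by (simp add: exp_add)
qed

text \<open>Writing \<open>p^2 s = 2 * m + \<delta> * p^2\<close> separates the sign, decided by
  parity, from a root of unity of order dividing \<open>p^2\<close> with exponent \<open>m\<close>.
  The congruence for \<open>p^2 s\<close> modulo \<open>p^2\<close> then gives \<open>m\<close> as
  \<open>K * h ^ p\<close>, with one \<open>K\<close> for all \<open>h\<close>.\<close>

lemma exp_gen_dedekind_sum:
  assumes p: "prime p" "p \<ge> 5"
  obtains K :: int where "coprime K (int p)"
    and "\<And>h. coprime h (int p) \<Longrightarrow>
      exp (of_real pi * \<i> * of_real (gen_dedekind_sum (p - 3) h p)) =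
      (if p mod 8 = 1 \<or> p mod 8 = 7 then 1 else - 1) * unity_exp (p\<^sup>2) (K * h ^ p)"
proof -
  have "odd p" using p prime_odd_nat by auto
  have p2: "p > 2" "p - 2 \<ge> 2" "p - 2 < p" "p - 2 - 1 = p - 3" "p - 3 + 1 = p - 2" using p by auto
  have r: "even (p - 3)" "p - 3 > 0" using \<open>odd p\<close> p by auto
  have "\<exists>f M. real_of_int f = real p ^ (p - 2) * powersum_fun (p - 2) (real j / real p) \<and>
      [p * M = j] (mod 4) \<and> [f = int (p ^ (p - 2) * (\<Sum>a<M. a ^ (p - 3)))] (mod 4) \<and>
      [2 * int (p - 2) * f = 2 * int j ^ (p - 2) - int (p - 2) * int p * int j ^ (p - 3)] (mod (int p)\<^sup>2)"
    for j
    using scaled_powersum_fun[OF p(1) p2(1-3), of j] unfolding p2(4) by metis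
  then obtain f M where f: "\<And>j. real_of_int (f j) = real p ^ (p - 2) * powersum_fun (p - 2) (real j / real p)"
    and M: "\<And>j. [p * M j = j] (mod 4)"
    and fM: "\<And>j. [f j = int (p ^ (p - 2) * (\<Sum>a<M j. a ^ (p - 3)))] (mod 4)"
    and fp: "\<And>j. [2 * int (p - 2) * f j = 2 * int j ^ (p - 2) - int (p - 2) * int p * int j ^ (p - 3)]
      (mod (int p)\<^sup>2)"
    by metis
  have parity: "\<exists>M. [p * M = j] (mod 4) \<and> (even (f j) \<longleftrightarrow> M mod 4 = 0 \<or> M mod 4 = 1)" for j
  proof -
    have "[f j = int (p ^ (p - 2) * (\<Sum>a<M j. a ^ (p - 3)))] (mod 2)"
      using fM[of j] by (rule cong_dvd_modulus) simp
    then have "even (f j) \<longleftrightarrow> even (\<Sum>a<M j. a ^ (p - 3))"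
      using \<open>odd p\<close> by (subst cong_dvd_iff) (auto simp del: of_nat_sum)
    with M even_powersum_iff[OF r(2)] show ?thesis by blast
  qed
  define C where "C = (\<Sum>j = 1..p - 1. int j ^ (p - 1))"
  define N where "N h = (\<Sum>j = 1..p - 1. f j * (int j * h mod int p))" for h
  have ded: "(real p)\<^sup>2 * gen_dedekind_sum (p - 3) h p = real_of_int (N h)"
    and anti: "\<And>j. j \<in> {1..p - 1} \<Longrightarrow> f (p - j) = - f j" if "coprime h (int p)" for h
    using gen_dedekind_sum_eq_sum_mod[OF r that, of f] f unfolding N_def p2(5) by blast+
  \<comment> \<open>By Fermat \<open>C\<close> is congruent to \<open>p - 1\<close>, that is to -1,
    hence a unit modulo \<open>p\<close>.\<close>
  have "[C = (\<Sum>j = 1..p - 1. 1)] (mod int p)"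
    unfolding C_def by (intro cong_sum fermat_theorem_int[OF p(1)]) (auto dest: dvd_imp_le)
  then have "[C + 1 = int (p - 1) + 1] (mod int p)" by (intro cong_add) auto
  then have "[C + 1 = int p] (mod int p)" using p by (simp add: of_nat_diff)
  then have "int p dvd C + 1" by (subst cong_dvd_iff) auto
  then have C: "coprime C (int p)"
    by (metis coprime_add_one_right coprime_commute coprime_divisors dvd_refl)
  have "coprime (2 * int (p - 2)) (int p)"
  proof -
    have "coprime (p - 2) p"
      using p by (metis coprime_commute diff_less less_le_trans nat_dvd_not_less pos2 prime_imp_coprime
          p2(2,3))
    then show ?thesis using \<open>odd p\<close> by simp
  qed
  then have "coprime (2 * int (p - 2)) ((int p)\<^sup>2)" by simp
  \<comment> \<open>The inverse of \<open>2 * (p - 2)\<close> solves for \<open>m\<close>; the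
    constant sought is \<open>K = I * C\<close>.\<close>
  then obtain I where I: "[2 * int (p - 2) * I = 1] (mod (int p)\<^sup>2)"
    using coprime_iff_invertible_int by auto
  show thesis
  proof (rule that)
    have "coprime I ((int p)\<^sup>2)"
      using I by (metis coprime_iff_invertible_int mult.commute)
    then show "coprime (I * C) (int p)" using C p by simp
    fix h assume h: "coprime h (int p)"
    define \<delta> :: int where "\<delta> = (if p mod 8 = 1 \<or> p mod 8 = 7 then 0 else 1)"
    have "even (N h) \<longleftrightarrow> p mod 8 = 1 \<or> p mod 8 = 7"
      unfolding N_def using even_sum_mult_mod[OF \<open>odd p\<close> h anti[OF h] parity] .
    \<comment> \<open>As \<open>p^2\<close> is odd, subtracting it once when \<open>N h\<close> is
      odd makes the difference even.\<close>
    then have "even (N h - \<delta> * (int p)\<^sup>2)"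
      using \<open>odd p\<close> by (auto simp: \<delta>_def)
    then obtain m where m: "N h = 2 * m + \<delta> * (int p)\<^sup>2"
      by (metis diff_eq_eq dvdE)
    have "[int (p - 2) * N h = C * h ^ p] (mod (int p)\<^sup>2)"
      unfolding N_def C_def using sum_mult_mod_cong[OF p(1) p2(1) h fp] .
    moreover have "2 * int (p - 2) * m - int (p - 2) * N h = (int p)\<^sup>2 * (- int (p - 2) * \<delta>)"
      unfolding m by (simp only: ring_distribs mult_ac minus_mult_left) simp
    then have "[2 * int (p - 2) * m = int (p - 2) * N h] (mod (int p)\<^sup>2)"
      unfolding cong_iff_dvd_diff by (metis dvd_triv_left)
    ultimately have "[2 * int (p - 2) * m = C * h ^ p] (mod (int p)\<^sup>2)"
      using cong_trans by blast
    then have "[I * (2 * int (p - 2) * m) = I * (C * h ^ p)] (mod (int p)\<^sup>2)"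
      by (rule cong_scalar_left)
    moreover have "[2 * int (p - 2) * I * m = 1 * m] (mod (int p)\<^sup>2)"
      using I by (rule cong_scalar_right)
    ultimately have mK: "[m = I * C * h ^ p] (mod int (p\<^sup>2))"
      by (simp add: mult_ac) (metis cong_sym cong_trans)
    have gen: "gen_dedekind_sum (p - 3) h p = 2 * real_of_int m / real (p\<^sup>2) + real_of_int \<delta>"
      using ded[OF h] p by (simp add: m field_simps)
    have "of_real pi * \<i> * of_real (gen_dedekind_sum (p - 3) h p) =
        2 * of_real pi * \<i> * of_int m / of_nat (p\<^sup>2) + of_int \<delta> * (of_real pi * \<i>)"
      unfolding gen by (simp add: distrib_left mult_ac)
    then show "exp (of_real pi * \<i> * of_real (gen_dedekind_sum (p - 3) h p)) =
      (if p mod 8 = 1 \<or> p mod 8 = 7 then 1 else - 1) * unity_exp (p\<^sup>2) (I * C * h ^ p)"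
      using p unity_exp_cong[OF mK] by (simp add: exp_add unity_exp_def \<delta>_def)
  qed
qed

section \<open>Primitive roots and Gaussian periods\<close>

lemma coprime_int_primroot:
  assumes "prime p" "int_primroot (p\<^sup>2) g"
  shows "coprime g (int p)"
proof -
  define a where "a = nat (g mod int (p\<^sup>2))"
  have "p > 0" using assms(1) prime_gt_0_nat by blast
  then have a: "[g = int a] (mod int (p\<^sup>2))" by (simp add: a_def cong_def)
  have "coprime a p"
    using assms(2) by (auto simp: int_primroot_def residue_primroot_def a_def coprime_commute)
  then have "coprime (int a) (int (p\<^sup>2))" by simp
  then have "coprime g (int (p\<^sup>2))" using a cong_imp_coprime cong_sym by blast
  then show ?thesis using \<open>p > 0\<close> by simp
qed

text \<open>In effect \<open>g\<close> is a primitive root modulo \<open>p\<close> as well: a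
  coincidence of powers modulo \<open>p\<close> lifts, on taking \<open>p\<close>-th powers, to one
  modulo \<open>p^2\<close>, where the order \<open>p * (p - 1)\<close> of \<open>g\<close> is
  known.\<close>

lemma bij_betw_primroot_power_mod:
  assumes p: "prime p" and g: "int_primroot (p\<^sup>2) g" and L: "coprime L (int p)"
  shows "bij_betw (\<lambda>j. L * g ^ Suc j mod int p) {0..p - 2} {1..int p - 1}"
proof (rule bij_betw_mod)
  define a where "a = nat (g mod int (p\<^sup>2))"
  have p2: "p \<ge> 2" using p prime_ge_2_nat by blast
  then have a: "[g = int a] (mod int (p\<^sup>2))" by (simp add: a_def cong_def)
  have root: "coprime (p\<^sup>2) a" "ord (p\<^sup>2) a = p * (p - 1)"
    using g p totient_prime_power_Suc[OF p, of 1]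
    by (auto simp: int_primroot_def residue_primroot_def a_def numeral_2_eq_2)
  have gp: "coprime g (int p)" by (rule coprime_int_primroot[OF p g])
  fix i j assume ij: "i \<in> {0..p - 2}" "j \<in> {0..p - 2}" "[L * g ^ Suc i = L * g ^ Suc j] (mod int p)"
  then have "[g ^ Suc i = g ^ Suc j] (mod int p)" using L cong_mult_lcancel by blast
  then have "[g ^ i * g = g ^ j * g] (mod int p)" by (simp add: mult.commute)
  then have "[g ^ i = g ^ j] (mod int p)" using gp cong_mult_rcancel by blast
  then have "[(g ^ i) ^ p = (g ^ j) ^ p] (mod int (p\<^sup>2))"
    using cong_power_prime_square by simp
  moreover have "[(g ^ k) ^ p = int (a ^ (p * k))] (mod int (p\<^sup>2))" for k
    using cong_pow[OF a, of "p * k"] by (simp add: power_mult mult.commute[of p])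
  ultimately have "[int (a ^ (p * i)) = int (a ^ (p * j))] (mod int (p\<^sup>2))"
    by (meson cong_sym cong_trans)
  then have "[a ^ (p * i) = a ^ (p * j)] (mod p\<^sup>2)" by (simp only: cong_int_iff)
  then have "[p * i = p * j] (mod p * (p - 1))"
    using order_divides_expdiff[OF root(1)] root(2) by simp
  then have "[i = j] (mod (p - 1))"
    using p2 by (simp add: cong_def flip: mult_mod_right)
  then show "i = j" using ij p2 by (intro cong_less_modulus_unique_nat) auto
next
  fix j
  have "coprime (L * g ^ Suc j) (int p)" using L coprime_int_primroot[OF p g] by simp
  moreover have "\<not> is_unit (int p)" using p by auto
  ultimately have "\<not> int p dvd L * g ^ Suc j" using coprime_commute coprime_absorb_left by blast
  then have "L * g ^ Suc j mod int p \<noteq> 0" by (simp add: dvd_eq_mod_eq_0)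
  moreover have "L * g ^ Suc j mod int p \<ge> 0" "L * g ^ Suc j mod int p < int p"
    using p prime_gt_0_nat by auto
  ultimately show "L * g ^ Suc j mod int p \<in> {1..int p - 1}" by auto
next
  show "card {0..p - 2} = card {1..int p - 1}" using prime_ge_2_nat[OF p] by auto
qed auto

lemma prod_affine_mod:
  fixes \<phi> :: "int \<Rightarrow> 'a :: comm_monoid_mult"
  assumes c: "coprime c (int p)" and "p > 0"
    and \<phi>: "\<And>x y. [x = y] (mod int p) \<Longrightarrow> \<phi> x = \<phi> y"
  shows "(\<Prod>n = 1..p. \<phi> (c * (v - int n))) = (\<Prod>n = 1..p. \<phi> (int n))"
proof -
  \<comment> \<open>Both products are compared with the one over least residues, taking for
    \<open>F\<close> the affine map and then the inclusion.\<close>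
  have "(\<Prod>n = 1..p. \<phi> (F n)) = (\<Prod>x \<in> {0..<int p}. \<phi> x)"
    if F: "\<And>x y. [F x = F y] (mod int p) \<Longrightarrow> [int x = int y] (mod int p)" for F
  proof -
    have "(\<Prod>n = 1..p. \<phi> (F n)) = (\<Prod>n = 1..p. \<phi> (F n mod int p))"
      by (intro prod.cong refl \<phi>) (simp add: cong_def)
    also have "\<dots> = (\<Prod>x \<in> {0..<int p}. \<phi> x)"
    proof (rule prod.reindex_bij_betw[OF bij_betw_mod])
      fix x y assume xy: "x \<in> {1..p}" "y \<in> {1..p}" "[F x = F y] (mod int p)"
      from F[OF xy(3)] have dvd: "int p dvd int x - int y" by (simp add: cong_iff_dvd_diff)
      show "x = y"
      proof (rule ccontr)
        assume "x \<noteq> y"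
        then have "int p \<le> \<bar>int x - int y\<bar>" using dvd_imp_le_int[OF _ dvd] by simp
        moreover have "\<bar>int x - int y\<bar> < int p" using xy(1,2) by auto
        ultimately show False by simp
      qed
    qed (use \<open>p > 0\<close> in auto)
    finally show ?thesis .
  qed
  note * = this
  have "[int x = int y] (mod int p)" if "[c * (v - int x) = c * (v - int y)] (mod int p)" for x y
  proof -
    have "[v - int x = v - int y] (mod int p)" using that c cong_mult_lcancel by blast
    from cong_diff[OF cong_refl[of v] this] show ?thesis by simp
  qed
  from *[of "\<lambda>n. c * (v - int n)", OF this] *[of int] show ?thesis by simp
qed

lemma gauss_period_eq_unity_exp:
  "gauss_period p g n = (\<Sum>j = 0..p - 2. unity_exp (p\<^sup>2) (g ^ (p * j) * (g ^ p + int p * n)))"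
  by (simp add: gauss_period_def unity_exp_def)

lemma gauss_period_cong:
  assumes "[m = n] (mod int p)" "p > 0"
  shows "gauss_period p g m = gauss_period p g n"
  unfolding gauss_period_eq_unity_exp
proof (intro sum.cong refl unity_exp_cong cong_scalar_left)
  show "[g ^ p + int p * m = g ^ p + int p * n] (mod int (p\<^sup>2))"
    using cong_add[OF cong_refl cong_mult_modulus[OF assms(1)]] by simp
qed (use assms(2) in auto)

text \<open>The summand of index \<open>h\<close> is a sign times the root of unity with exponent
  \<open>K * h ^ p - p * h * n\<close>. Putting \<open>h = L * g ^ (j + 1)\<close> with
  \<open>L\<close> inverse to \<open>K\<close> modulo \<open>p\<close> turns this exponent into that
  of a Gaussian period whose index is affine in \<open>n\<close>, with slope given by
  \<open>c = L * g\<close>.\<close>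

lemma wilf_sum_eq_gauss_period:
  assumes p: "prime p" "p \<ge> 5" and g: "int_primroot (p\<^sup>2) g"
  obtains c v :: int where "coprime c (int p)"
    and "\<And>n. wilf_sum (p - 3) p n =
      (if p mod 8 = 1 \<or> p mod 8 = 7 then 1 else - 1) * gauss_period p g (c * (v - n))"
proof -
  define \<epsilon> :: complex where "\<epsilon> = (if p mod 8 = 1 \<or> p mod 8 = 7 then 1 else - 1)"
  obtain K where K: "coprime K (int p)"
    and ded: "\<And>h. coprime h (int p) \<Longrightarrow>
      exp (of_real pi * \<i> * of_real (gen_dedekind_sum (p - 3) h p)) = \<epsilon> * unity_exp (p\<^sup>2) (K * h ^ p)"
    using exp_gen_dedekind_sum[OF p] unfolding \<epsilon>_def by metis
  obtain L where L: "[K * L = 1] (mod int p)"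
    using K coprime_iff_invertible_int by auto
  then have Lp: "coprime L (int p)" by (metis coprime_iff_invertible_int mult.commute)
  have frob: "[x ^ p = x] (mod int p)" if "coprime x (int p)" for x :: int
  proof -
    have "\<not> is_unit (int p)" using p by auto
    then have "\<not> int p dvd x" using that coprime_commute coprime_absorb_left by blast
    from cong_scalar_left[OF fermat_theorem_int[OF p(1) this], of x] show ?thesis
      using p by (simp add: power_eq_if)
  qed
  \<comment> \<open>\<open>K * L\<close> is 1 only modulo \<open>p\<close>, so \<open>K\<close> is
    replaced by its \<open>p\<close>-th power to make \<open>(K * L) ^ p\<close> equal to 1 modulo
    \<open>p^2\<close>; the error \<open>p * v\<close> becomes a shift of the index
    \<open>n\<close>.\<close>
  obtain v where v: "K = K ^ p + int p * v"
    using frob[OF K] by (metis cong_iff_lin)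
  show thesis
  proof (rule that)
    show "coprime (L * g) (int p)" using Lp coprime_int_primroot[OF p(1) g] by simp
    fix n :: int
    define \<psi> where "\<psi> h = unity_exp (p\<^sup>2) ((K * h) ^ p + int p * (h * (v - n)))" for h
    have \<psi>: "\<psi> x = \<psi> y" if "[x = y] (mod int p)" for x y
      unfolding \<psi>_def using p that
      by (intro unity_exp_cong cong_add)
        (auto intro!: cong_power_prime_square cong_mult_modulus intro: cong_scalar_left cong_scalar_right)
    have "{h. h \<in> {1..int p} \<and> coprime h (int p)} = {1..int p - 1}"
    proof -
      have "coprime h (int p)" if "h \<in> {1..int p - 1}" for h
        using that p zdvd_not_zless[of h "int p"] prime_imp_coprime[of "int p" h]
        by (auto simp: coprime_commute)
      moreover have "\<not> coprime (int p) (int p)" using p by simp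
      moreover have "h \<in> {1..int p - 1}" if "h \<in> {1..int p}" "coprime h (int p)" for h
        using that calculation(2) by (cases "h = int p") auto
      ultimately show ?thesis by auto
    qed
    then have "wilf_sum (p - 3) p n = (\<Sum>h = 1..int p - 1. exp (of_real pi * \<i> * of_real (gen_dedekind_sum (p - 3) h p)
        - 2 * of_real pi * \<i> * of_int h * of_int n / of_nat p))"
      unfolding wilf_sum_def by simp
    also have "\<dots> = (\<Sum>h = 1..int p - 1. \<epsilon> * \<psi> h)"
    proof (rule sum.cong[OF refl])
      fix h assume "h \<in> {1..int p - 1}"
      then have h: "coprime h (int p)"
        using p zdvd_not_zless[of h "int p"] prime_imp_coprime[of "int p" h]
        by (auto simp: coprime_commute)
      have "K * h ^ p - int p * (h * n) - ((K * h) ^ p + int p * (h * (v - n))) =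
          int p * (v * h ^ p) - int p * (v * h)"
        by (subst v) (simp add: algebra_simps power_mult_distrib)
      \<comment> \<open>Behind the factor \<open>p\<close>, Fermat allows \<open>h ^ p\<close> to be
        replaced by \<open>h\<close>.\<close>
      moreover have "(int p)\<^sup>2 dvd int p * (v * h ^ p) - int p * (v * h)"
        using cong_mult_modulus[OF cong_scalar_left[OF frob[OF h], of v]]
        by (simp add: cong_iff_dvd_diff)
      ultimately have "[K * h ^ p - int p * (h * n) = (K * h) ^ p + int p * (h * (v - n))] (mod int (p\<^sup>2))"
        by (simp add: cong_iff_dvd_diff)
      from unity_exp_cong[OF this] have "\<psi> h = unity_exp (p\<^sup>2) (K * h ^ p - int p * (h * n))"
        using p by (simp add: \<psi>_def)
      also have "\<dots> = unity_exp (p\<^sup>2) (K * h ^ p) * exp (- (2 * of_real pi * \<i> * of_int h * of_int n / of_nat p))"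
        using p by (simp add: unity_exp_def field_simps power2_eq_square flip: exp_add)
      finally show "exp (of_real pi * \<i> * of_real (gen_dedekind_sum (p - 3) h p)
          - 2 * of_real pi * \<i> * of_int h * of_int n / of_nat p) = \<epsilon> * \<psi> h"
        using ded[OF h] by (simp add: exp_diff exp_minus field_simps)
    qed
    also have "\<dots> = \<epsilon> * (\<Sum>h = 1..int p - 1. \<psi> h)" by (simp add: sum_distrib_left)
    \<comment> \<open>The exponent \<open>Suc j\<close> rather than \<open>j\<close> produces the
      factor \<open>g ^ p\<close> in the definition of the period.\<close>
    also have "(\<Sum>h = 1..int p - 1. \<psi> h) = (\<Sum>j = 0..p - 2. \<psi> (L * g ^ Suc j mod int p))"
      by (rule sum.reindex_bij_betw[OF bij_betw_primroot_power_mod[OF p(1) g Lp], symmetric])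
    also have "\<dots> = (\<Sum>j = 0..p - 2. \<psi> (L * g ^ Suc j))"
      by (intro sum.cong refl \<psi>) (simp add: cong_def)
    also have "\<dots> = gauss_period p g (L * g * (v - n))"
      unfolding gauss_period_eq_unity_exp \<psi>_def
    proof (intro sum.cong refl unity_exp_cong)
      fix j
      have "[K * L * g ^ Suc j = 1 * g ^ Suc j] (mod int p)" using L by (rule cong_scalar_right)
      then have "[K * (L * g ^ Suc j) = g ^ Suc j] (mod int p)" by (simp add: mult.assoc)
      then have "[(K * (L * g ^ Suc j)) ^ p = (g ^ Suc j) ^ p] (mod (int p)\<^sup>2)"
        by (rule cong_power_prime_square)
      moreover have "(g ^ Suc j) ^ p = g ^ (p * j) * g ^ p"
        by (simp add: power_mult[symmetric] power_mult_distrib mult_ac)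
      \<comment> \<open>Fermat is used backwards: \<open>g ^ j\<close> becomes
        \<open>g ^ (p * j)\<close>, so that this power factors out of the whole exponent.\<close>
      moreover have "[int p * (L * g ^ Suc j * (v - n)) = int p * (g ^ (p * j) * (L * g * (v - n)))] (mod (int p)\<^sup>2)"
      proof (rule cong_mult_modulus)
        have "[g ^ j = (g ^ j) ^ p] (mod int p)"
          using frob[of "g ^ j"] coprime_int_primroot[OF p(1) g] by (simp add: cong_sym)
        from cong_scalar_right[OF this, of "L * g * (v - n)"]
        show "[L * g ^ Suc j * (v - n) = g ^ (p * j) * (L * g * (v - n))] (mod int p)"
          by (simp add: power_mult[symmetric] mult_ac)
      qed
      ultimately have "[(K * (L * g ^ Suc j)) ^ p + int p * (L * g ^ Suc j * (v - n)) =
          g ^ (p * j) * g ^ p + int p * (g ^ (p * j) * (L * g * (v - n)))] (mod (int p)\<^sup>2)"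
        by (metis cong_add)
      then show "[(K * (L * g ^ Suc j)) ^ p + int p * (L * g ^ Suc j * (v - n)) =
          g ^ (p * j) * (g ^ p + int p * (L * g * (v - n)))] (mod int (p\<^sup>2))"
        by (simp only: distrib_left of_nat_power mult.left_commute[of "g ^ (p * j)" "int p"])
    qed (use p in auto)
    finally show "wilf_sum (p - 3) p n =
        (if p mod 8 = 1 \<or> p mod 8 = 7 then 1 else - 1) * gauss_period p g (L * g * (v - n))"
      unfolding \<epsilon>_def .
  qed
qed

section \<open>Comparison of the two polynomials\<close>

theorem theorem1:
  fixes p :: nat and g :: int
  assumes "prime p" and "p \<ge> 5"
    and "int_primroot (p\<^sup>2) g"
  shows "([int p = 1] (mod 8) \<or> [int p = -1] (mod 8) \<longrightarrow>
            wilf_poly (p - 3) p = period_poly p g) \<and>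
         ([int p = 3] (mod 8) \<or> [int p = -3] (mod 8) \<longrightarrow>
            wilf_poly (p - 3) p = - pcompose (period_poly p g) [:0, -1:])"
proof -
  define \<epsilon> :: complex where "\<epsilon> = (if p mod 8 = 1 \<or> p mod 8 = 7 then 1 else - 1)"
  obtain c v where c: "coprime c (int p)"
    and wilf: "\<And>n. wilf_sum (p - 3) p n = \<epsilon> * gauss_period p g (c * (v - n))"
    using wilf_sum_eq_gauss_period[OF assms] unfolding \<epsilon>_def by metis
  define \<phi> :: "int \<Rightarrow> complex poly" where "\<phi> m = [:- (\<epsilon> * gauss_period p g m), 1:]" for m
  have "wilf_poly (p - 3) p = (\<Prod>n = 1..p. \<phi> (c * (v - int n)))"
    by (simp add: wilf_poly_def wilf \<phi>_def)
  \<comment> \<open>The periods depend on their index only modulo \<open>p\<close>, and the affine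
    map permutes the residues.\<close>
  also have "\<dots> = (\<Prod>n = 1..p. \<phi> (int n))"
    using assms(2) gauss_period_cong[of _ _ p g] by (intro prod_affine_mod[OF c]) (auto simp: \<phi>_def)
  finally have W: "wilf_poly (p - 3) p = (\<Prod>n = 1..p. [:- (\<epsilon> * gauss_period p g (int n)), 1:])"
    by (simp add: \<phi>_def)
  have "wilf_poly (p - 3) p = period_poly p g" if "\<epsilon> = 1"
    using W that by (simp add: period_poly_def)
  moreover have "wilf_poly (p - 3) p = - pcompose (period_poly p g) [:0, -1:]" if "\<epsilon> = - 1"
  proof -
    \<comment> \<open>Substituting \<open>- x\<close> turns each factor into the negative of
      \<open>x\<close> plus the period; the signs combine to -1 because \<open>p\<close> is
      odd.\<close>
    have "pcompose (period_poly p g) [:0, -1:] = (\<Prod>n = 1..p. - [:gauss_period p g (int n), 1:])"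
      by (simp add: period_poly_def pcompose_prod pcompose_pCons)
    also have "\<dots> = (-1) ^ p * (\<Prod>n = 1..p. [:gauss_period p g (int n), 1:])"
      by (simp only: prod_uminus) simp
    also have "(-1 :: complex poly) ^ p = -1"
      using assms(1,2) prime_odd_nat[of p] by simp
    finally show ?thesis using W that by simp
  qed
  moreover have mod8: "int p mod 8 = int (p mod 8)" by (simp add: zmod_int)
  have "[int p = 1] (mod 8) \<longleftrightarrow> p mod 8 = 1" "[int p = -1] (mod 8) \<longleftrightarrow> p mod 8 = 7"
    "[int p = 3] (mod 8) \<longleftrightarrow> p mod 8 = 3" "[int p = -3] (mod 8) \<longleftrightarrow> p mod 8 = 5"
    by (simp_all add: cong_def mod8)
  ultimately show ?thesis by (auto simp: \<epsilon>_def)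
qed

end
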